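(* Let $G$ be a totally disconnected, locally compact group. Then: (a) For every $\alpha\in\operatorname{Aut}(G)$, the set of prime divisors of $r_G(\alpha)$ is a subset of $\mathbb L(G)$. (b) $\mathbb P(G)\subseteq\mathbb L(G)$ holds, and indeed $\mathbb P(G)\subseteq\mathbb L_r(G)$.
   Context: All topological groups are Hausdorff; $\operatorname{Aut}(G)$ is the group of automorphisms of the topological group $G$. For a totally disconnected, locally compact group $G$ and $\alpha\in\operatorname{Aut}(G)$, a compact open subgroup $U$ is tidy for $\alpha$ if (T1) $U=U_+U_-$ with $U_\pm:=\bigcap_{n\in\mathbb N_0}\alpha^{\pm n}(U)$; and (T2) $\bigcup_{n\in\mathbb N_0}\alpha^n(U_+)$ is closed in $G$. Tidy subgroups exist, and the scale $r_G(\alpha):=[\alpha(U_+):U_+]$ is finite and independent of $U$. The scale function is $s_G(x):=r_G(I_x)$ with $I_x(y)=xyx^{-1}$; $\mathbb P(G)$ is the set of primes dividing $s_G(x)$ for some $x\in G$. The local prime content $\mathbb L(G)$ is the set of all primes $p$ such that, for every compact open subgroup $U\subseteq G$, $p$ divides the index $[U:V]$ for some compact open subgroup $V\subseteq U$. The reduced prime content is $\mathbb L_r(G):=\bigcap_K\mathbb L(G/K)$, where $K$ runs through all compact normal subgroups of $G$. *)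

theory Defs
  imports
    "HOL-Algebra.Coset"
    "HOL-Analysis.Analysis"
    "HOL-Computational_Algebra.Primes"
begin

text \<open>Topological groups are Hausdorff by convention. Both the algebraic and the topological structure
  live on the carrier set, so that quotient groups are again instances.\<close>

locale topological_group = group G for G (structure) +
  fixes T :: "'a topology"
  assumes topspace_eq: "topspace T = carrier G"
    and continuous_mult: "continuous_map (prod_topology T T) T (\<lambda>(x, y). x \<otimes> y)"
    and continuous_inv: "continuous_map T T (\<lambda>x. inv x)"
    and Hausdorff: "Hausdorff_space T"

definition totally_disconnected_space :: "'a topology \<Rightarrow> bool" where
  "totally_disconnected_space T \<longleftrightarrow> (\<forall>x \<in> topspace T. connected_component_of_set T x = {x})"

locale tdlc_group = topological_group +
  assumes locally_compact: "locally_compact_space T"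
    and totally_disconnected: "totally_disconnected_space T"

text \<open>Values of automorphisms outside the carrier are irrelevant and left unrestricted.\<close>

definition topological_automorphisms :: "('a, 'b) monoid_scheme \<Rightarrow> 'a topology \<Rightarrow> ('a \<Rightarrow> 'a) set" where
  "topological_automorphisms G T = {\<alpha> \<in> iso G G. homeomorphic_map T T \<alpha>}"

definition compact_open_subgroup :: "('a, 'b) monoid_scheme \<Rightarrow> 'a topology \<Rightarrow> 'a set \<Rightarrow> bool" where
  "compact_open_subgroup G T U \<longleftrightarrow> subgroup U G \<and> compactin T U \<and> openin T U"

text \<open>The index of \<open>K\<close> in \<open>H\<close>, for subgroups \<open>K \<subseteq> H\<close> of \<open>G\<close>. An infinite index is represented by 0,
  which every prime divides.\<close>

definition group_index :: "('a, 'b) monoid_scheme \<Rightarrow> 'a set \<Rightarrow> 'a set \<Rightarrow> nat" where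
  "group_index G H K = card (rcosets\<^bsub>G\<lparr>carrier := H\<rparr>\<^esub> K)"

definition tidy_plus :: "('a \<Rightarrow> 'a) \<Rightarrow> 'a set \<Rightarrow> 'a set" where
  "tidy_plus \<alpha> U = (\<Inter>n::nat. (\<alpha> ^^ n) ` U)"

definition tidy_minus :: "('a, 'b) monoid_scheme \<Rightarrow> ('a \<Rightarrow> 'a) \<Rightarrow> 'a set \<Rightarrow> 'a set" where
  "tidy_minus G \<alpha> U = (\<Inter>n::nat. (inv_into (carrier G) \<alpha> ^^ n) ` U)"

definition tidy :: "('a, 'b) monoid_scheme \<Rightarrow> 'a topology \<Rightarrow> ('a \<Rightarrow> 'a) \<Rightarrow> 'a set \<Rightarrow> bool" where
  "tidy G T \<alpha> U \<longleftrightarrow>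
     compact_open_subgroup G T U \<and>
     U = tidy_plus \<alpha> U <#>\<^bsub>G\<^esub> tidy_minus G \<alpha> U \<and>
     closedin T (\<Union>n::nat. (\<alpha> ^^ n) ` tidy_plus \<alpha> U)"

text \<open>\<open>has_scale G T \<alpha> r\<close> reads: the scale of \<open>\<alpha>\<close> is \<open>r\<close>. By Willis's theorems, an automorphism of a
  totally disconnected, locally compact group has exactly one scale, and it is positive; like
  \<open>has_integral\<close>, the relation presupposes none of this, so a statement about all \<open>r\<close> with
  \<open>has_scale G T \<alpha> r\<close> concerns every subgroup tidy for \<open>\<alpha>\<close>.\<close>

definition has_scale :: "('a, 'b) monoid_scheme \<Rightarrow> 'a topology \<Rightarrow> ('a \<Rightarrow> 'a) \<Rightarrow> nat \<Rightarrow> bool" where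
  "has_scale G T \<alpha> r \<longleftrightarrow>
     (\<exists>U. tidy G T \<alpha> U \<and> r = group_index G (\<alpha> ` tidy_plus \<alpha> U) (tidy_plus \<alpha> U))"

definition inner_automorphism :: "('a, 'b) monoid_scheme \<Rightarrow> 'a \<Rightarrow> 'a \<Rightarrow> 'a" where
  "inner_automorphism G x = (\<lambda>y. x \<otimes>\<^bsub>G\<^esub> y \<otimes>\<^bsub>G\<^esub> inv\<^bsub>G\<^esub> x)"

definition prime_content :: "('a, 'b) monoid_scheme \<Rightarrow> 'a topology \<Rightarrow> nat set" where
  "prime_content G T =
     {p. prime p \<and> (\<exists>x \<in> carrier G. \<exists>r. has_scale G T (inner_automorphism G x) r \<and> p dvd r)}"

definition local_prime_content :: "('a, 'b) monoid_scheme \<Rightarrow> 'a topology \<Rightarrow> nat set" where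
  "local_prime_content G T =
     {p. prime p \<and>
         (\<forall>U. compact_open_subgroup G T U \<longrightarrow>
            (\<exists>V. compact_open_subgroup G T V \<and> V \<subseteq> U \<and> p dvd group_index G U V))}"

definition quotient_group_topology :: "('a, 'b) monoid_scheme \<Rightarrow> 'a topology \<Rightarrow> 'a set \<Rightarrow> 'a set topology" where
  "quotient_group_topology G T K =
     topology (\<lambda>W. W \<subseteq> carrier (G Mod K) \<and> openin T {x \<in> topspace T. K #>\<^bsub>G\<^esub> x \<in> W})"

lemma openin_quotient_group_topology:
  "openin (quotient_group_topology G T K) W \<longleftrightarrow>
     W \<subseteq> carrier (G Mod K) \<and> openin T {x \<in> topspace T. K #>\<^bsub>G\<^esub> x \<in> W}"
proof -
  let ?P = "\<lambda>W. W \<subseteq> carrier (G Mod K) \<and> openin T {x \<in> topspace T. K #>\<^bsub>G\<^esub> x \<in> W}"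
  have "?P (A \<inter> B)" if "?P A" "?P B" for A B
  proof -
    have "{x \<in> topspace T. K #>\<^bsub>G\<^esub> x \<in> A \<inter> B} =
        {x \<in> topspace T. K #>\<^bsub>G\<^esub> x \<in> A} \<inter> {x \<in> topspace T. K #>\<^bsub>G\<^esub> x \<in> B}"
      by blast
    then show ?thesis
      using that by auto
  qed
  moreover have "?P (\<Union>\<A>)" if "\<forall>A\<in>\<A>. ?P A" for \<A>
  proof -
    have "{x \<in> topspace T. K #>\<^bsub>G\<^esub> x \<in> \<Union>\<A>} = (\<Union>A\<in>\<A>. {x \<in> topspace T. K #>\<^bsub>G\<^esub> x \<in> A})"
      by blast
    then show ?thesis
      using that by auto
  qed
  ultimately have "istopology ?P"
    unfolding istopology_def by blast
  then show ?thesis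
    unfolding quotient_group_topology_def by simp
qed

lemma (in topological_group) quotient_map_quotient_group_topology:
  "quotient_map T (quotient_group_topology G T K) (\<lambda>x. K #> x)"
proof -
  have "{x \<in> topspace T. K #> x \<in> carrier (G Mod K)} = topspace T"
    by (auto simp: FactGroup_def RCOSETS_def topspace_eq)
  then have "openin (quotient_group_topology G T K) (carrier (G Mod K))"
    by (simp add: openin_quotient_group_topology)
  then have "topspace (quotient_group_topology G T K) = carrier (G Mod K)"
    by (meson openin_quotient_group_topology openin_subset openin_topspace subset_antisym)
  then show ?thesis
    by (auto simp: quotient_map_def openin_quotient_group_topology FactGroup_def RCOSETS_def topspace_eq)
qed

definition reduced_prime_content :: "('a, 'b) monoid_scheme \<Rightarrow> 'a topology \<Rightarrow> nat set" where
  "reduced_prime_content G T =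
     (\<Inter>K \<in> {K. K \<lhd> G \<and> compactin T K}. local_prime_content (G Mod K) (quotient_group_topology G T K))"

end

theory Submission
  imports Defs "HOL-Algebra.Zassenhaus"
begin

text \<open>Let \<open>U\<close> be tidy for \<open>\<alpha>\<close>, let \<open>r\<close> be the scale, and put \<open>V\<^sub>n = U \<inter> \<alpha>\<^sup>-\<^sup>1(U) \<inter> \<dots> \<inter> \<alpha>\<^sup>-\<^sup>n(U)\<close>. Let \<open>K\<close> be a compact
  normal subgroup with \<open>\<alpha>(K) \<subseteq> K\<close>. Because \<open>U = U\<^sub>+U\<^sub>-\<close> and \<open>U\<^sub>- \<subseteq> V\<^sub>n\<close>, we have \<open>UK = V\<^sub>nKU\<^sub>+\<close>, so
  \<open>[UK : V\<^sub>nK] = [U\<^sub>+ : U\<^sub>+ \<inter> V\<^sub>nK]\<close>. By (T2) and the Baire category theorem, an element of \<open>U\<^sub>+\<close> whose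
  forward orbit lies in a compact set never leaves \<open>U\<^sub>+\<close>; this forces \<open>U\<^sub>+ \<inter> V\<^sub>nK = \<alpha>\<^sup>-\<^sup>n(U\<^sub>+)\<close>, and the index
  is \<open>[\<alpha>\<^sup>n(U\<^sub>+) : U\<^sub>+] = r\<^sup>n\<close>. Given a prime \<open>p\<close> dividing \<open>r\<close> and a compact open subgroup \<open>W \<supseteq> K\<close>, choose
  \<open>n\<close> such that \<open>p\<^sup>n\<close> does not divide the finite index \<open>[UK : W \<inter> UK]\<close>. As \<open>p\<^sup>n\<close> divides
  \<open>[UK : W \<inter> V\<^sub>nK]\<close>, the prime \<open>p\<close> divides \<open>[W : W \<inter> V\<^sub>nK]\<close>. The case \<open>K = {1}\<close> is (a), and general \<open>K\<close>
  with \<open>\<alpha>\<close> inner gives the statement about \<open>G/K\<close>.\<close>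

section \<open>Coset counts, finite subcovers and indices of subgroups\<close>

text \<open>Both images are in bijection with the classes of one equivalence relation on
  \<open>A\<close>. This is how indices in different groups get compared; infinite images are
  included, with value 0 on both sides.\<close>

lemma card_image_cong_kernel:
  assumes "\<And>x y. x \<in> A \<Longrightarrow> y \<in> A \<Longrightarrow> f x = f y \<longleftrightarrow> g x = g y"
  shows "card (f ` A) = card (g ` A)"
proof (rule bij_betw_same_card)
  let ?h = "\<lambda>X. g (inv_into A f X)"
  have h: "?h (f x) = g x" if "x \<in> A" for x
    using that assms by (metis f_inv_into_f image_eqI inv_into_into)
  show "bij_betw ?h (f ` A) (g ` A)"
    unfolding bij_betw_def inj_on_def using h assms by (force simp: image_image)
qed

text \<open>Keeps the points that index the cover: later covers consist of translates, and the
  arguments go on to use their finitely many centres.\<close>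

lemma compactin_indexed_subcover:
  assumes S: "compactin X S" and op: "\<forall>Y \<in> f ` I. openin X Y" and cover: "S \<subseteq> \<Union>(f ` I)"
  obtains F where "finite F" "F \<subseteq> I" "S \<subseteq> \<Union>(f ` F)"
proof -
  obtain \<F> where \<F>: "finite \<F>" "\<F> \<subseteq> f ` I" "S \<subseteq> \<Union>\<F>"
    using S op cover unfolding compactin_def by metis
  obtain F where "F \<subseteq> I" "finite F" "\<F> = f ` F"
    using finite_subset_image[OF \<F>(1,2)] by blast
  then show ?thesis
    using that \<F>(3) by simp
qed

text \<open>Right cosets use only the multiplication, so shrinking the carrier to \<open>H\<close>
  merely restricts the representatives.\<close>

lemma group_index_eq: "group_index G H K = card ((\<lambda>h. K #>\<^bsub>G\<^esub> h) ` H)"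
  by (simp add: group_index_def RCOSETS_def r_coset_def UNION_singleton_eq_range)

context group
begin

lemma inv_cancel_left:
  assumes "x \<in> carrier G" "y \<in> carrier G"
  shows "inv x \<otimes> (x \<otimes> y) = y" "x \<otimes> (inv x \<otimes> y) = y"
  using assms by (simp_all flip: m_assoc)

lemma r_coset_eq_iff:
  assumes "subgroup H G" "x \<in> carrier G" "y \<in> carrier G"
  shows "H #> x = H #> y \<longleftrightarrow> x \<otimes> inv y \<in> H"
  using assms
  by (metis is_group repr_independence rcos_self subgroup.rcos_module)

text \<open>A choice of representatives for the cosets of \<open>B\<close> in \<open>C\<close>
  matches the cosets of \<open>A\<close> in \<open>C\<close> with pairs of cosets. As no set of
  cosets here is empty, the value 0 for an infinite index obeys the same product rule.\<close>

lemma group_index_mult: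
  assumes A: "subgroup A G" and B: "subgroup B G" and C: "subgroup C G"
    and "A \<subseteq> B" "B \<subseteq> C"
  shows "group_index G C A = group_index G C B * group_index G B A"
proof -
  let ?r = "inv_into C (\<lambda>c. B #> c)"
  have sub: "A \<subseteq> carrier G" "B \<subseteq> carrier G" "C \<subseteq> carrier G"
    using A B C by (auto dest: subgroup.subset)
  have r: "?r X \<in> C" "B #> ?r X = X" if "X \<in> (\<lambda>c. B #> c) ` C" for X
    using that by (simp_all add: inv_into_into f_inv_into_f[of X "\<lambda>c. B #> c"])
  have inj: "X = X' \<and> A #> b = A #> b'"
    if X: "X \<in> (\<lambda>c. B #> c) ` C" "X' \<in> (\<lambda>c. B #> c) ` C" and b: "b \<in> B" "b' \<in> B"
      and eq: "(A #> b) #> ?r X = (A #> b') #> ?r X'" for X X' b b'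
  proof -
    let ?s = "?r X" and ?s' = "?r X'"
    have car: "b \<in> carrier G" "b' \<in> carrier G" "?s \<in> carrier G" "?s' \<in> carrier G"
      using X b r sub by auto
    \<comment> \<open>Removing \<open>b\<close> and \<open>b'\<close>, which lie in
      \<open>B\<close>, puts both representatives into one coset of \<open>B\<close>. Hence they are
      equal and cancel, and \<open>b\<close>, \<open>b'\<close> agree modulo
      \<open>A\<close>.\<close>
    have "(b \<otimes> ?s) \<otimes> inv (b' \<otimes> ?s') \<in> A"
      using eq car sub by (simp add: coset_mult_assoc r_coset_eq_iff A)
    then have m: "b \<otimes> (?s \<otimes> inv ?s') \<otimes> inv b' \<in> A"
      using car by (simp add: inv_mult_group m_assoc)
    then have "inv b \<otimes> (b \<otimes> (?s \<otimes> inv ?s') \<otimes> inv b') \<otimes> b' \<in> B"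
      using \<open>A \<subseteq> B\<close> b B by (meson subgroup.m_closed subgroup.m_inv_closed subsetD)
    moreover have "inv b \<otimes> (b \<otimes> (?s \<otimes> inv ?s') \<otimes> inv b') \<otimes> b' = ?s \<otimes> inv ?s'"
      using car by (simp add: m_assoc inv_cancel_left)
    ultimately have "?s \<otimes> inv ?s' \<in> B"
      by simp
    then have "B #> ?s = B #> ?s'"
      using car B by (simp add: r_coset_eq_iff)
    then have XX: "X = X'"
      using r X by metis
    with m car have "b \<otimes> inv b' \<in> A"
      by simp
    then show ?thesis
      using XX car A by (simp add: r_coset_eq_iff)
  qed
  have into: "(A #> b) #> ?r X \<in> (\<lambda>c. A #> c) ` C"
    if X: "X \<in> (\<lambda>c. B #> c) ` C" and b: "b \<in> B" for X b
  proof -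
    have "b \<otimes> ?r X \<in> C"
      using C r[OF X] b \<open>B \<subseteq> C\<close> by (blast intro: subgroup.m_closed)
    moreover have "(A #> b) #> ?r X = A #> (b \<otimes> ?r X)"
      using r[OF X] b sub by (intro coset_mult_assoc) auto
    ultimately show ?thesis
      by blast
  qed
  have onto: "\<exists>X \<in> (\<lambda>c. B #> c) ` C. \<exists>b \<in> B. A #> c = (A #> b) #> ?r X" if c: "c \<in> C" for c
  proof -
    let ?s = "?r (B #> c)"
    have s: "?s \<in> C" "B #> ?s = B #> c"
      using r c by auto
    have car: "c \<in> carrier G" "?s \<in> carrier G"
      using s c sub by auto
    have "c \<otimes> inv ?s \<in> B"
      using s(2) car B r_coset_eq_iff by metis
    moreover have "(A #> (c \<otimes> inv ?s)) #> ?s = A #> c"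
      using car sub by (simp add: coset_mult_assoc m_assoc)
    ultimately show ?thesis
      using c by (metis imageI)
  qed
  have "bij_betw (\<lambda>(X, Y). Y #> ?r X) ((\<lambda>c. B #> c) ` C \<times> (\<lambda>b. A #> b) ` B) ((\<lambda>c. A #> c) ` C)"
    unfolding bij_betw_def
  proof
    show "inj_on (\<lambda>(X, Y). Y #> ?r X) ((\<lambda>c. B #> c) ` C \<times> (\<lambda>b. A #> b) ` B)"
      using inj unfolding inj_on_def by blast
    show "(\<lambda>(X, Y). Y #> ?r X) ` ((\<lambda>c. B #> c) ` C \<times> (\<lambda>b. A #> b) ` B) = (\<lambda>c. A #> c) ` C"
      using into onto by (fastforce simp: image_iff)
  qed
  then show ?thesis
    unfolding group_index_eq by (metis bij_betw_same_card card_cartesian_product)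
qed

text \<open>Elements of \<open>H\<close> represent all cosets of \<open>V\<close> in the product,
  and two of them give the same coset exactly when they agree modulo \<open>H \<inter> V\<close>.
  The count makes sense even if the product is no subgroup.\<close>

lemma group_index_set_mult:
  assumes H: "subgroup H G" and V: "subgroup V G"
  shows "group_index G (V <#> H) V = group_index G H (H \<inter> V)"
proof -
  have sub: "H \<subseteq> carrier G" "V \<subseteq> carrier G"
    using assms by (auto dest: subgroup.subset)
  have coset: "V #> (v \<otimes> h) = V #> h" if "v \<in> V" "h \<in> H" for v h
    using that sub V coset_mult_assoc[of V v h] by (auto simp: coset_join2)
  have image: "(\<lambda>m. V #> m) ` (V <#> H) = (\<lambda>h. V #> h) ` H"
  proof
    show "(\<lambda>m. V #> m) ` (V <#> H) \<subseteq> (\<lambda>h. V #> h) ` H"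
      using coset by (auto simp: set_mult_def)
    have "h \<in> V <#> H" if "h \<in> H" for h
      using that V sub by (force simp: set_mult_def dest: subgroup.one_closed)
    then show "(\<lambda>h. V #> h) ` H \<subseteq> (\<lambda>m. V #> m) ` (V <#> H)"
      by blast
  qed
  have kernel: "V #> x = V #> y \<longleftrightarrow> (H \<inter> V) #> x = (H \<inter> V) #> y" if "x \<in> H" "y \<in> H" for x y
  proof -
    have "x \<otimes> inv y \<in> H"
      using that H by (blast intro: subgroup.m_closed subgroup.m_inv_closed)
    then show ?thesis
      using that sub H V by (simp add: r_coset_eq_iff subgroups_Inter_pair subset_iff)
  qed
  show ?thesis
    unfolding group_index_eq image by (intro card_image_cong_kernel kernel)
qed

end

text \<open>Because \<open>A\<close> contains the kernel, an element whose image lies in the image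
  of \<open>A\<close> already lies in \<open>A\<close>. Applied to injective iterates of
  \<open>\<alpha>\<close> and to the projection modulo \<open>K\<close>.\<close>

lemma (in group_hom) group_index_image:
  assumes A: "subgroup A G" and B: "subgroup B G" and ker: "kernel G H h \<subseteq> A"
  shows "group_index H (h ` B) (h ` A) = group_index G B A"
proof -
  have "h ` A #>\<^bsub>H\<^esub> h x = h ` A #>\<^bsub>H\<^esub> h y \<longleftrightarrow> A #> x = A #> y" if "x \<in> B" "y \<in> B" for x y
  proof -
    have car: "x \<in> carrier G" "y \<in> carrier G"
      using that B by (auto dest: subgroup.subset)
    have "x \<otimes> inv y \<in> A" if "h (x \<otimes> inv y) = h a" "a \<in> A" for a
    proof -
      have a: "a \<in> carrier G"
        using that A by (auto dest: subgroup.subset)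
      then have "x \<otimes> inv y \<otimes> inv a \<in> kernel G H h"
        using that car by (simp add: kernel_def)
      then have "x \<otimes> inv y \<otimes> inv a \<otimes> a \<in> A"
        using ker that A by (blast intro: subgroup.m_closed)
      then show ?thesis
        using a car by (simp add: G.m_assoc)
    qed
    then have "h (x \<otimes> inv y) \<in> h ` A \<longleftrightarrow> x \<otimes> inv y \<in> A"
      by blast
    moreover have "h (x \<otimes> inv y) = h x \<otimes>\<^bsub>H\<^esub> inv\<^bsub>H\<^esub> h y"
      using car by simp
    ultimately show ?thesis
      using car A
      by (metis G.r_coset_eq_iff H.r_coset_eq_iff hom_closed subgroup_img_is_subgroup)
  qed
  then show ?thesis
    unfolding group_index_eq image_image by (intro card_image_cong_kernel) auto
qed

section \<open>Compact open subgroups of a topological group\<close>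

context topological_group
begin

lemma continuous_map_mult:
  assumes "continuous_map X T f" "continuous_map X T g"
  shows "continuous_map X T (\<lambda>x. f x \<otimes> g x)"
  using continuous_map_compose[OF continuous_map_pairedI[OF assms] continuous_mult]
  by (simp add: o_def)

lemma openin_r_coset:
  assumes A: "openin T A" and c: "c \<in> carrier G"
  shows "openin T (A #> c)"
proof -
  have sub: "A \<subseteq> carrier G"
    using openin_subset[OF A] by (simp add: topspace_eq)
  have "continuous_map T T (\<lambda>x. x \<otimes> inv c)"
    using c by (intro continuous_map_mult) (auto simp: topspace_eq)
  then have "openin T {x \<in> topspace T. x \<otimes> inv c \<in> A}"
    using A by (rule openin_continuous_map_preimage)
  also have "{x \<in> topspace T. x \<otimes> inv c \<in> A} = A #> c"
  proof (intro equalityI subsetI)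
    fix x assume "x \<in> {x \<in> topspace T. x \<otimes> inv c \<in> A}"
    then have "x \<otimes> inv c \<in> A" "x = x \<otimes> inv c \<otimes> c"
      using c by (auto simp: topspace_eq m_assoc)
    then show "x \<in> A #> c"
      unfolding r_coset_def by blast
  next
    fix x assume "x \<in> A #> c"
    then show "x \<in> {x \<in> topspace T. x \<otimes> inv c \<in> A}"
      using sub c by (auto simp: r_coset_def topspace_eq m_assoc subset_iff)
  qed
  finally show ?thesis .
qed

lemma openin_set_mult:
  assumes "openin T A" "B \<subseteq> carrier G"
  shows "openin T (A <#> B)"
proof -
  have eq: "A <#> B = (\<Union>b\<in>B. A #> b)"
    by (auto simp: set_mult_def r_coset_def)
  show ?thesis
    unfolding eq using assms openin_r_coset by (intro openin_Union) blast
qed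

lemma compactin_set_mult:
  assumes "compactin T A" "compactin T B"
  shows "compactin T (A <#> B)"
proof -
  have "A <#> B = (\<lambda>(x, y). x \<otimes> y) ` (A \<times> B)"
    by (force simp: set_mult_def)
  then show ?thesis
    using image_compactin[OF _ continuous_mult, of "A \<times> B"] assms by (simp add: compactin_Times)
qed

lemma compact_imp_closedin: "compactin T A \<Longrightarrow> closedin T A"
  using Hausdorff compactin_imp_closedin by blast

text \<open>The cosets of \<open>A\<close> are open and pairwise disjoint, so a finite subcover of
  \<open>C\<close> contains all those that meet \<open>C\<close>. Since 0 encodes an infinite index,
  being nonzero expresses finiteness.\<close>

lemma finite_index:
  assumes A: "compact_open_subgroup G T A" and C: "compact_open_subgroup G T C"
  shows "group_index G C A \<noteq> 0"
proof -
  have sg: "subgroup A G" "subgroup C G" and sub: "A \<subseteq> carrier G" "C \<subseteq> carrier G"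
    using A C by (auto simp: compact_open_subgroup_def dest: subgroup.subset)
  let ?\<C> = "(\<lambda>c. A #> c) ` C"
  have "\<forall>X \<in> ?\<C>. openin T X"
    using A sub openin_r_coset by (auto simp: compact_open_subgroup_def)
  moreover have "C \<subseteq> \<Union>?\<C>"
    using rcos_self[OF _ sg(1)] sub by blast
  ultimately obtain \<F> where \<F>: "finite \<F>" "\<F> \<subseteq> ?\<C>" "C \<subseteq> \<Union>\<F>"
    using C unfolding compact_open_subgroup_def compactin_def by metis
  have "?\<C> \<subseteq> \<F>"
  proof clarify
    fix c assume c: "c \<in> C"
    then obtain X where "X \<in> \<F>" "c \<in> X"
      using \<F> by blast
    moreover obtain d where d: "d \<in> C" "X = A #> d"
      using \<F> \<open>X \<in> \<F>\<close> by blast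
    ultimately show "A #> c \<in> \<F>"
      using repr_independence[of c A d] sg sub by auto
  qed
  then have "finite ?\<C>"
    using \<F>(1) by (rule finite_subset)
  moreover have "?\<C> \<noteq> {}"
    using sg(2) by (auto dest: subgroup.one_closed)
  ultimately show ?thesis
    unfolding group_index_eq card_eq_0_iff by blast
qed

lemma compact_open_subgroup_Int:
  assumes "compact_open_subgroup G T A" "compact_open_subgroup G T B"
  shows "compact_open_subgroup G T (A \<inter> B)"
  using assms unfolding compact_open_subgroup_def
  by (blast intro: subgroups_Inter_pair closed_Int_compactin compact_imp_closedin openin_Int)

lemma compact_open_subgroup_set_mult:
  assumes U: "compact_open_subgroup G T U" and K: "K \<lhd> G" "compactin T K"
  shows "compact_open_subgroup G T (U <#> K)"
proof -
  have sub: "subgroup U G" "openin T U" "compactin T U" "K \<subseteq> carrier G"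
    using U subgroup.subset[OF normal_imp_subgroup[OF K(1)]] by (auto simp: compact_open_subgroup_def)
  have "subgroup (U <#> K) G"
    using mult_norm_subgroup[OF K(1) sub(1)] commut_normal[OF sub(1) K(1)] by simp
  then show ?thesis
    unfolding compact_open_subgroup_def
    using compactin_set_mult[OF sub(3) K(2)] openin_set_mult[OF sub(2,4)] by blast
qed

end

section \<open>Iterates of an automorphism and the factors of a tidy subgroup\<close>

text \<open>Common source of the subgroup property of \<open>P\<close>, \<open>N\<close> and
  \<open>V n\<close>, all cut out by requiring certain iterates to stay in \<open>U\<close>.\<close>

lemma (in group) subgroup_preimages:
  assumes U: "subgroup U G" and f: "\<And>i. i \<in> I \<Longrightarrow> f i \<in> hom G G"
  shows "subgroup {x \<in> carrier G. \<forall>i \<in> I. f i x \<in> U} G"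
proof -
  have hom: "group_hom G G (f i)" if "i \<in> I" for i
    using f[OF that] by (simp add: group_hom_def group_hom_axioms_def)
  show ?thesis
    using U by unfold_locales (auto simp: group_hom.hom_mult[OF hom] group_hom.hom_inv[OF hom]
        group_hom.hom_one[OF hom] subgroup.m_closed subgroup.m_inv_closed subgroup.one_closed)
qed

lemma funpow_iso: "f \<in> iso G G \<Longrightarrow> f ^^ n \<in> iso G G"
proof (induction n)
  case 0
  show ?case by (simp add: iso_set_refl id_def)
next
  case (Suc n)
  then show ?case
    unfolding funpow.simps by (blast intro: iso_set_trans)
qed

lemma funpow_homeomorphic_map: "homeomorphic_map T T f \<Longrightarrow> homeomorphic_map T T (f ^^ n)"
  by (induction n) (auto intro: homeomorphic_map_compose)

lemma funpow_add_apply: "(f ^^ m) ((f ^^ n) x) = (f ^^ (m + n)) x"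
  by (simp add: funpow_add)

locale tidy_subgroup = topological_group +
  fixes \<alpha> :: "'a \<Rightarrow> 'a" and U :: "'a set"
  assumes automorphism: "\<alpha> \<in> topological_automorphisms G T"
    and tidy: "tidy G T \<alpha> U"
begin

text \<open>\<open>P\<close> and \<open>N\<close> are the subgroups \<open>U\<^sub>+\<close> and \<open>U\<^sub>-\<close>.\<close>

abbreviation "\<beta> \<equiv> inv_into (carrier G) \<alpha>"
abbreviation "P \<equiv> tidy_plus \<alpha> U"
abbreviation "N \<equiv> tidy_minus G \<alpha> U"

lemma iso_fwd: "\<alpha> ^^ n \<in> iso G G"
  using automorphism by (auto simp: topological_automorphisms_def intro: funpow_iso)

lemma iso_bwd: "\<beta> ^^ n \<in> iso G G"
  using iso_fwd[of 1] by (auto intro: funpow_iso iso_set_sym)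

lemma group_hom_fwd: "group_hom G G (\<alpha> ^^ n)"
  using iso_fwd by (simp add: group_hom_def group_hom_axioms_def iso_def)

lemma continuous_fwd: "continuous_map T T (\<alpha> ^^ n)"
  using automorphism
  by (auto simp: topological_automorphisms_def intro: homeomorphic_imp_continuous_map funpow_homeomorphic_map)

lemma carrier_fwd [simp]: "x \<in> carrier G \<Longrightarrow> (\<alpha> ^^ n) x \<in> carrier G"
  using iso_fwd[of n] by (auto simp: iso_def hom_def)

lemma carrier_bwd [simp]: "x \<in> carrier G \<Longrightarrow> (\<beta> ^^ n) x \<in> carrier G"
  using iso_bwd[of n] by (auto simp: iso_def hom_def)

lemma bij: "bij_betw \<alpha> (carrier G) (carrier G)"
  using iso_fwd[of 1] by (simp add: iso_def)

lemma fwd_bwd [simp]: "x \<in> carrier G \<Longrightarrow> (\<alpha> ^^ n) ((\<beta> ^^ n) x) = x"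
proof (induction n arbitrary: x)
  case (Suc n)
  have "(\<alpha> ^^ n) (\<alpha> (\<beta> ((\<beta> ^^ n) x))) = x"
    using Suc bij by (simp add: bij_betw_inv_into_right)
  then show ?case
    by (simp add: funpow_swap1)
qed simp

lemma bwd_fwd [simp]: "x \<in> carrier G \<Longrightarrow> (\<beta> ^^ n) ((\<alpha> ^^ n) x) = x"
proof (induction n arbitrary: x)
  case (Suc n)
  have "(\<beta> ^^ n) (\<beta> (\<alpha> ((\<alpha> ^^ n) x))) = x"
    using Suc bij by (simp add: bij_betw_inv_into_left)
  then show ?case
    by (simp add: funpow_swap1)
qed simp

lemma bwd_fwd_le:
  assumes "x \<in> carrier G" "m \<le> n"
  shows "(\<beta> ^^ m) ((\<alpha> ^^ n) x) = (\<alpha> ^^ (n - m)) x" "(\<alpha> ^^ m) ((\<beta> ^^ n) x) = (\<beta> ^^ (n - m)) x"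
proof -
  have "(\<alpha> ^^ n) x = (\<alpha> ^^ m) ((\<alpha> ^^ (n - m)) x)" "(\<beta> ^^ n) x = (\<beta> ^^ m) ((\<beta> ^^ (n - m)) x)"
    using assms(2) by (simp_all add: funpow_add_apply)
  then show "(\<beta> ^^ m) ((\<alpha> ^^ n) x) = (\<alpha> ^^ (n - m)) x" "(\<alpha> ^^ m) ((\<beta> ^^ n) x) = (\<beta> ^^ (n - m)) x"
    using assms(1) by simp_all
qed

text \<open>Trades images for conditions on orbits, the form in which \<open>P\<close> and
  \<open>N\<close> are handled from here on.\<close>

lemma mem_fwd_image: "A \<subseteq> carrier G \<Longrightarrow> x \<in> (\<alpha> ^^ n) ` A \<longleftrightarrow> x \<in> carrier G \<and> (\<beta> ^^ n) x \<in> A"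
  by (auto simp: image_iff subset_iff) (metis fwd_bwd)

lemma mem_bwd_image: "A \<subseteq> carrier G \<Longrightarrow> x \<in> (\<beta> ^^ n) ` A \<longleftrightarrow> x \<in> carrier G \<and> (\<alpha> ^^ n) x \<in> A"
  by (auto simp: image_iff subset_iff) (metis bwd_fwd)

lemma compact_open: "compact_open_subgroup G T U"
  and U_factor: "U = P <#> N"
  and closed_union: "closedin T (\<Union>n. (\<alpha> ^^ n) ` P)"
  using tidy by (auto simp: tidy_def)

lemma U_subgroup: "subgroup U G"
  using compact_open by (simp add: compact_open_subgroup_def)

lemma U_carrier: "U \<subseteq> carrier G"
  by (intro subgroup.subset U_subgroup)

lemma mem_plus: "x \<in> P \<longleftrightarrow> x \<in> carrier G \<and> (\<forall>n. (\<beta> ^^ n) x \<in> U)"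
  unfolding tidy_plus_def using mem_fwd_image[OF U_carrier] by blast

lemma mem_minus: "x \<in> N \<longleftrightarrow> x \<in> carrier G \<and> (\<forall>n. (\<alpha> ^^ n) x \<in> U)"
  unfolding tidy_minus_def using mem_bwd_image[OF U_carrier] by blast

lemma P_subgroup: "subgroup P G"
proof -
  have "P = {x \<in> carrier G. \<forall>n\<in>UNIV. (\<beta> ^^ n) x \<in> U}"
    using mem_plus by auto
  moreover have "\<beta> ^^ n \<in> hom G G" for n
    using iso_bwd by (simp add: iso_def)
  ultimately show ?thesis
    using subgroup_preimages[OF U_subgroup, of UNIV "\<lambda>n. \<beta> ^^ n"] by simp
qed

lemma N_subgroup: "subgroup N G"
proof -
  have "N = {x \<in> carrier G. \<forall>n\<in>UNIV. (\<alpha> ^^ n) x \<in> U}"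
    using mem_minus by auto
  moreover have "\<alpha> ^^ n \<in> hom G G" for n
    using iso_fwd by (simp add: iso_def)
  ultimately show ?thesis
    using subgroup_preimages[OF U_subgroup, of UNIV "\<lambda>n. \<alpha> ^^ n"] by simp
qed

lemma P_le_U: "P \<subseteq> U" and N_le_U: "N \<subseteq> U"
proof -
  have "(\<beta> ^^ 0) x \<in> U" if "x \<in> P" for x
    using that mem_plus by blast
  moreover have "(\<alpha> ^^ 0) x \<in> U" if "x \<in> N" for x
    using that mem_minus by blast
  ultimately show "P \<subseteq> U" "N \<subseteq> U"
    by auto
qed

lemma P_carrier: "P \<subseteq> carrier G" and N_carrier: "N \<subseteq> carrier G"
  using P_le_U N_le_U U_carrier by auto

lemma P_bwd: "x \<in> P \<Longrightarrow> (\<beta> ^^ n) x \<in> P"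
  by (simp add: mem_plus funpow_add_apply)

lemma P_compact: "compactin T P"
proof -
  have c: "compactin T ((\<alpha> ^^ n) ` U)" for n
    using compact_open continuous_fwd by (auto simp: compact_open_subgroup_def intro: image_compactin)
  then have "closedin T P"
    unfolding tidy_plus_def by (intro closedin_Inter) (auto intro: compact_imp_closedin)
  then show ?thesis
    using compact_open P_le_U closed_compactin unfolding compact_open_subgroup_def by blast
qed

section \<open>The ascending chain of images of \<open>P\<close>\<close>

lemma fwd_P_mono:
  assumes "m \<le> n"
  shows "(\<alpha> ^^ m) ` P \<subseteq> (\<alpha> ^^ n) ` P"
proof
  fix x assume "x \<in> (\<alpha> ^^ m) ` P"
  then have x: "x \<in> carrier G" "(\<beta> ^^ m) x \<in> P"
    by (auto simp: mem_fwd_image[OF P_carrier])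
  have "(\<beta> ^^ n) x = (\<beta> ^^ (n - m)) ((\<beta> ^^ m) x)"
    using assms by (simp add: funpow_add_apply)
  then show "x \<in> (\<alpha> ^^ n) ` P"
    using x P_bwd by (simp add: mem_fwd_image[OF P_carrier])
qed

lemma fwd_P_subgroup: "subgroup ((\<alpha> ^^ n) ` P) G"
  using group_hom.subgroup_img_is_subgroup[OF group_hom_fwd P_subgroup] .

text \<open>By the Baire category theorem one of the subgroups \<open>\<alpha>\<^sup>n(U\<^sub>+)\<close> has an interior point in the closed
  subgroup \<open>L\<close>; hence all later ones are open in \<open>L\<close>.\<close>

lemma compact_subset_fwd_P:
  assumes lc: "locally_compact_space T" and C: "compactin T C"
  defines "L \<equiv> \<Union>n. (\<alpha> ^^ n) ` P"
  shows "\<exists>n. C \<inter> L \<subseteq> (\<alpha> ^^ n) ` P"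
proof -
  have L: "closedin T L" "L \<subseteq> carrier G"
    using closed_union subgroup.subset[OF fwd_P_subgroup] unfolding L_def by blast+
  let ?X = "subtopology T L"
  have topX: "topspace ?X = L"
    using L by (auto simp: topspace_eq)
  have X: "locally_compact_space ?X" "Hausdorff_space ?X"
    using L lc Hausdorff by (auto intro: locally_compact_space_closed_subset Hausdorff_space_subtopology)
  have "\<one> \<in> L"
    using subgroup.one_closed[OF fwd_P_subgroup[of 0]] unfolding L_def by blast
  \<comment> \<open>The union is the whole space \<open>?X\<close>, so its interior contains
    \<open>\<one>\<close>. By Baire, the countably many closed sets cannot all have empty
    interior.\<close>
  then have "?X interior_of \<Union>(range (\<lambda>n. (\<alpha> ^^ n) ` P)) \<noteq> {}"
    using topX interior_of_topspace[of ?X] L_def by auto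
  moreover have "closedin ?X ((\<alpha> ^^ n) ` P)" for n
  proof -
    have "closedin T ((\<alpha> ^^ n) ` P)"
      using P_compact continuous_fwd image_compactin compact_imp_closedin by blast
    then show ?thesis
      by (auto simp: closedin_subtopology L_def)
  qed
  ultimately have "\<exists>n. ?X interior_of ((\<alpha> ^^ n) ` P) \<noteq> {}"
    using Baire_category_alt[of ?X "range (\<lambda>n. (\<alpha> ^^ n) ` P)"] X
      locally_compact_Hausdorff_imp_regular_space[OF X] by auto
  then obtain n where "?X interior_of ((\<alpha> ^^ n) ` P) \<noteq> {}"
    by blast
  then obtain g O1 where O: "openin ?X O1" "g \<in> O1" "O1 \<subseteq> (\<alpha> ^^ n) ` P"
    unfolding interior_of_def by blast
  then obtain O2 where O2: "openin T O2" "O1 = O2 \<inter> L"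
    by (auto simp: openin_subtopology)
  have g: "g \<in> (\<alpha> ^^ n) ` P" "g \<in> carrier G"
    using O L O2 by auto
  \<comment> \<open>The translate of \<open>O2\<close> that carries \<open>g\<close> to
    \<open>c\<close>, hence a neighbourhood of \<open>c\<close>.\<close>
  let ?Q = "\<lambda>c. O2 #> (inv g \<otimes> c)"
  have Q: "openin T (?Q c)" "c \<in> ?Q c" if "c \<in> L" for c
  proof -
    show "openin T (?Q c)"
      using that L g O2 by (intro openin_r_coset) auto
    have "c = g \<otimes> (inv g \<otimes> c)"
      using that L g by (simp add: inv_cancel_left subset_iff)
    then show "c \<in> ?Q c"
      using O(2) O2 unfolding r_coset_def by blast
  qed
  \<comment> \<open>Write \<open>x = y \<otimes> d\<close> with
    \<open>d = inv g \<otimes> c\<close>. Both \<open>x\<close> and \<open>d\<close> lie in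
    \<open>L\<close>, hence so does \<open>y\<close>; being in \<open>O2\<close> as well,
    \<open>y\<close> lies in the \<open>n\<close>-th image of \<open>P\<close>. Thus
    \<open>x\<close> lies in the \<open>m\<close>-th image together with \<open>y\<close> and
    \<open>d\<close>.\<close>
  have Q_sub: "?Q c \<inter> L \<subseteq> (\<alpha> ^^ m) ` P" if c: "c \<in> (\<alpha> ^^ m) ` P" and "n \<le> m" for c m
  proof
    fix x assume "x \<in> ?Q c \<inter> L"
    then obtain y where y: "y \<in> O2" "x = y \<otimes> (inv g \<otimes> c)" and "x \<in> L"
      by (auto simp: r_coset_def)
    then obtain k where k: "x \<in> (\<alpha> ^^ k) ` P"
      by (auto simp: L_def)
    let ?A = "\<lambda>k. (\<alpha> ^^ k) ` P"
    have gm: "g \<in> ?A m"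
      using g fwd_P_mono \<open>n \<le> m\<close> by blast
    then have d: "inv g \<otimes> c \<in> ?A m"
      using c fwd_P_subgroup by (blast intro: subgroup.m_closed subgroup.m_inv_closed)
    \<comment> \<open>There is no control over \<open>k\<close>; it only serves to see that
      \<open>y\<close> lies in the union.\<close>
    have "x \<in> ?A (max k m)" "inv g \<otimes> c \<in> ?A (max k m)"
      using k d fwd_P_mono[of k "max k m"] fwd_P_mono[of m "max k m"] by auto
    then have "x \<otimes> inv (inv g \<otimes> c) \<in> ?A (max k m)"
      using fwd_P_subgroup by (blast intro: subgroup.m_closed subgroup.m_inv_closed)
    moreover have "x \<otimes> inv (inv g \<otimes> c) = y"
    proof -
      have "y \<in> carrier G" "inv g \<otimes> c \<in> carrier G"
        using y O2 openin_subset[OF O2(1)] subgroup.subset[OF fwd_P_subgroup] d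
        by (auto simp: topspace_eq)
      then show ?thesis
        using y by (simp add: m_assoc)
    qed
    ultimately have "y \<in> ?A n"
      using O(3) O2 y unfolding L_def by blast
    then have "y \<in> ?A m"
      using fwd_P_mono \<open>n \<le> m\<close> by blast
    then show "x \<in> ?A m"
      using y d fwd_P_subgroup by (auto intro: subgroup.m_closed)
  qed
  have "compactin T (C \<inter> L)"
    using C L by (auto intro: compact_Int_closedin)
  moreover have "\<forall>W \<in> ?Q ` (C \<inter> L). openin T W" "C \<inter> L \<subseteq> \<Union>(?Q ` (C \<inter> L))"
    using Q by blast+
  ultimately obtain F where F: "finite F" "F \<subseteq> C \<inter> L" "C \<inter> L \<subseteq> \<Union>(?Q ` F)"
    by (rule compactin_indexed_subcover)
  have "\<exists>m\<ge>n. F \<subseteq> (\<alpha> ^^ m) ` P"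
    using F(1,2)
  proof (induction F)
    case empty
    then show ?case by auto
  next
    case (insert c F)
    then obtain m k where "m \<ge> n" "F \<subseteq> (\<alpha> ^^ m) ` P" "c \<in> (\<alpha> ^^ k) ` P"
      unfolding L_def by blast
    then have "max m k \<ge> n" "insert c F \<subseteq> (\<alpha> ^^ max m k) ` P"
      using fwd_P_mono[of m "max m k"] fwd_P_mono[of k "max m k"] by auto
    then show ?case by blast
  qed
  then obtain m where "m \<ge> n" "F \<subseteq> (\<alpha> ^^ m) ` P"
    by blast
  then have "C \<inter> L \<subseteq> (\<alpha> ^^ m) ` P"
    using F(3) Q_sub by blast
  then show ?thesis ..
qed

text \<open>A single \<open>m\<close>-th image of \<open>P\<close> catches the whole orbit. Looking
  \<open>n + m\<close> steps ahead and going back \<open>m\<close> steps lands in \<open>P\<close>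
  at time \<open>n\<close>.\<close>

lemma bounded_forward_orbit:
  assumes lc: "locally_compact_space T" and C: "compactin T C"
    and x: "x \<in> P" and orbit: "\<And>n. (\<alpha> ^^ n) x \<in> C"
  shows "(\<alpha> ^^ n) x \<in> P"
proof -
  obtain m where m: "C \<inter> (\<Union>n. (\<alpha> ^^ n) ` P) \<subseteq> (\<alpha> ^^ m) ` P"
    using compact_subset_fwd_P[OF lc C] by blast
  have "(\<alpha> ^^ (n + m)) x \<in> (\<alpha> ^^ m) ` P"
    using m orbit x by blast
  then have "(\<beta> ^^ m) ((\<alpha> ^^ (n + m)) x) \<in> P"
    by (simp add: mem_fwd_image[OF P_carrier])
  then show ?thesis
    using x P_carrier by (simp add: bwd_fwd_le subset_iff)
qed

section \<open>The index of \<open>V n <#> K\<close> in \<open>U <#> K\<close> and its prime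
  divisors\<close>

definition V :: "nat \<Rightarrow> 'a set" where
  "V n = {x \<in> carrier G. \<forall>k\<in>{..n}. (\<alpha> ^^ k) x \<in> U}"

lemma V_le_U: "V n \<subseteq> U"
proof
  fix x assume "x \<in> V n"
  then have "(\<alpha> ^^ 0) x \<in> U"
    unfolding V_def by blast
  then show "x \<in> U"
    by simp
qed

text \<open>Only the finitely many times up to \<open>n\<close> are constrained, so
  \<open>V n\<close> is open, while the intersection \<open>N\<close> of all \<open>V n\<close> is
  in general only closed.\<close>

lemma compact_open_V: "compact_open_subgroup G T (V n)"
proof -
  have V: "V n = (\<Inter>k\<in>{..n}. {x \<in> topspace T. (\<alpha> ^^ k) x \<in> U})"
    by (auto simp: V_def topspace_eq)
  have "openin T U" "compactin T U" "closedin T U"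
    using compact_open compact_imp_closedin by (auto simp: compact_open_subgroup_def)
  moreover from this have "openin T (V n)" "closedin T (V n)"
    unfolding V using continuous_fwd
    by (auto intro!: openin_INT2 closedin_INT openin_continuous_map_preimage closedin_continuous_map_preimage)
  moreover have "subgroup (V n) G"
    unfolding V_def using iso_fwd by (intro subgroup_preimages U_subgroup) (simp add: iso_def)
  ultimately show ?thesis
    using V_le_U closed_compactin unfolding compact_open_subgroup_def by blast
qed

lemma V_subgroup: "subgroup (V n) G"
  using compact_open_V by (simp add: compact_open_subgroup_def)

lemma N_le_V: "N \<subseteq> V n"
  by (auto simp: V_def mem_minus)

text \<open>Split off the bottom step of the chain, from \<open>P\<close> to its first image. What
  remains is the image under the injective \<open>\<alpha>\<close> of the chain of length
  \<open>n\<close>, so every step contributes the same index.\<close>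

lemma prime_power_dvd_index:
  assumes "p dvd group_index G (\<alpha> ` P) P"
  shows "p ^ n dvd group_index G ((\<alpha> ^^ n) ` P) P"
proof (induction n)
  case (Suc n)
  interpret hom: group_hom G G \<alpha>
    using group_hom_fwd[of 1] by simp
  have "kernel G G \<alpha> = {\<one>}"
    using bij hom.inj_iff_trivial_ker bij_betw_def by blast
  then have ker: "kernel G G \<alpha> \<subseteq> P"
    using P_subgroup subgroup.one_closed by fastforce
  have sub: "P \<subseteq> \<alpha> ` P" "\<alpha> ` P \<subseteq> (\<alpha> ^^ Suc n) ` P" "subgroup (\<alpha> ` P) G"
    using fwd_P_mono[of 0 1] fwd_P_mono[of 1 "Suc n"] fwd_P_subgroup[of 1] by auto
  have "group_index G ((\<alpha> ^^ Suc n) ` P) P =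
      group_index G (\<alpha> ` (\<alpha> ^^ n) ` P) (\<alpha> ` P) * group_index G (\<alpha> ` P) P"
    using group_index_mult[OF P_subgroup sub(3) fwd_P_subgroup sub(1,2)]
    by (simp add: image_comp)
  also have "group_index G (\<alpha> ` (\<alpha> ^^ n) ` P) (\<alpha> ` P) = group_index G ((\<alpha> ^^ n) ` P) P"
    using P_subgroup fwd_P_subgroup ker by (rule hom.group_index_image)
  finally show ?case
    using mult_dvd_mono[OF Suc assms] by (simp add: mult.commute)
qed simp

text \<open>Normality lets elements of \<open>K\<close> pass elements of \<open>P\<close> by
  conjugation, which leaves only the factorisation of \<open>U\<close>.\<close>

lemma set_mult_VK_P:
  assumes K: "K \<lhd> G"
  shows "(V n <#> K) <#> P = U <#> K"
proof
  have Kc: "K \<subseteq> carrier G"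
    using K by (simp add: normal_imp_subgroup subgroup.subset)
  note car = U_carrier[THEN subsetD] P_carrier[THEN subsetD] Kc[THEN subsetD]
  show "(V n <#> K) <#> P \<subseteq> U <#> K"
  proof
    fix x assume "x \<in> (V n <#> K) <#> P"
    then obtain v k q where x: "v \<in> V n" "k \<in> K" "q \<in> P" "x = v \<otimes> k \<otimes> q"
      by (auto simp: set_mult_def)
    have "v \<in> U" "q \<in> U"
      using x V_le_U P_le_U by auto
    then have "x = (v \<otimes> q) \<otimes> (inv q \<otimes> k \<otimes> q)"
      using x by (simp add: car m_assoc inv_cancel_left)
    moreover have "v \<otimes> q \<in> U"
      using \<open>v \<in> U\<close> \<open>q \<in> U\<close> U_subgroup by (simp add: subgroup.m_closed)
    moreover have "inv q \<otimes> k \<otimes> q \<in> K"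
      using x car K by (simp add: normal.inv_op_closed1)
    ultimately show "x \<in> U <#> K"
      by (auto simp: set_mult_def)
  qed
  show "U <#> K \<subseteq> (V n <#> K) <#> P"
  proof
    fix x assume "x \<in> U <#> K"
    then obtain u k where x: "u \<in> U" "k \<in> K" "x = u \<otimes> k"
      by (auto simp: set_mult_def)
    \<comment> \<open>(T1) puts the factor in \<open>P\<close> first, but here it has to come last;
      factoring the inverse reverses the order.\<close>
    have "inv u \<in> P <#> N"
      using x U_subgroup U_factor by (metis subgroup.m_inv_closed)
    then obtain q m where q: "q \<in> P" "m \<in> N" "inv u = q \<otimes> m"
      by (auto simp: set_mult_def)
    then have c: "q \<in> carrier G" "m \<in> carrier G" "u \<in> carrier G" "k \<in> carrier G"
      using x car N_carrier by auto
    have "u = inv m \<otimes> inv q"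
      using q c by (metis inv_inv inv_mult_group)
    then have "x = inv m \<otimes> (inv q \<otimes> k \<otimes> q) \<otimes> inv q"
      using c x by (simp add: m_assoc)
    moreover have "inv m \<in> V n" "inv q \<in> P"
      using q N_le_V N_subgroup P_subgroup by (blast intro: subgroup.m_inv_closed)+
    moreover have "inv q \<otimes> k \<otimes> q \<in> K"
      using x c K by (simp add: normal.inv_op_closed1)
    ultimately show "x \<in> (V n <#> K) <#> P"
      by (auto simp: set_mult_def)
  qed
qed

text \<open>Writing \<open>y = abk\<close> with \<open>a \<in> U\<^sub>+\<close>, \<open>b \<in> U\<^sub>-\<close>, \<open>k \<in> K\<close>, the element \<open>a\<^sup>-\<^sup>1y = bk\<close> of \<open>U\<^sub>+\<close> has its forward
  orbit in the compact set \<open>UK\<close>.\<close>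

lemma fwd_image_P_Int_VK:
  assumes lc: "locally_compact_space T" and K: "K \<lhd> G" "compactin T K" "\<alpha> ` K \<subseteq> K"
  shows "(\<alpha> ^^ n) ` (P \<inter> (V n <#> K)) = P"
proof
  have Ksub: "subgroup K G" "K \<subseteq> carrier G"
    using K by (auto simp: normal_imp_subgroup subgroup.subset)
  have Kfwd: "(\<alpha> ^^ j) k \<in> K" if "k \<in> K" for j k
    using that K(3) by (induction j) auto
  show "(\<alpha> ^^ n) ` (P \<inter> (V n <#> K)) \<subseteq> P"
  proof clarify
    fix y assume y: "y \<in> P" "y \<in> V n <#> K"
    then obtain v k where v: "v \<in> V n" and k: "k \<in> K" and yvk: "y = v \<otimes> k"
      by (auto simp: set_mult_def)
    then have "v \<in> P <#> N"
      using V_le_U U_factor by blast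
    then obtain a b where a: "a \<in> P" and b: "b \<in> N" and vab: "v = a \<otimes> b"
      by (auto simp: set_mult_def)
    have c: "a \<in> carrier G" "b \<in> carrier G" "k \<in> carrier G" "y \<in> carrier G"
      using a b k y P_carrier N_carrier Ksub by auto
    have fwd_mult: "(\<alpha> ^^ j) (x \<otimes> z) = (\<alpha> ^^ j) x \<otimes> (\<alpha> ^^ j) z"
      if "x \<in> carrier G" "z \<in> carrier G" for j x z
      using that group_hom.hom_mult[OF group_hom_fwd] by blast
    have a_fwd: "(\<alpha> ^^ j) a \<in> U" if "j \<le> n" for j
    proof -
      have "(\<alpha> ^^ j) v \<in> U" "(\<alpha> ^^ j) b \<in> U"
        using v b that by (auto simp: V_def mem_minus)
      moreover have "(\<alpha> ^^ j) a = (\<alpha> ^^ j) v \<otimes> inv ((\<alpha> ^^ j) b)"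
        using c by (simp add: vab fwd_mult m_assoc)
      ultimately show ?thesis
        using U_subgroup by (simp add: subgroup.m_closed subgroup.m_inv_closed)
    qed
    \<comment> \<open>Going back at most \<open>n\<close> steps is covered by \<open>a_fwd\<close>;
      any further steps follow the backward orbit of \<open>a\<close>, which stays in
      \<open>U\<close> because \<open>a\<close> is in \<open>P\<close>.\<close>
    have a_n: "(\<alpha> ^^ n) a \<in> P"
      unfolding mem_plus
    proof (intro conjI allI)
      fix m
      show "(\<beta> ^^ m) ((\<alpha> ^^ n) a) \<in> U"
      proof (cases "m \<le> n")
        case True
        then show ?thesis
          using c a_fwd by (simp add: bwd_fwd_le)
      next
        case False
        then have "(\<beta> ^^ m) ((\<alpha> ^^ n) a) = (\<beta> ^^ (m - n)) ((\<beta> ^^ n) ((\<alpha> ^^ n) a))"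
          by (simp add: funpow_add_apply)
        then show ?thesis
          using a c by (simp add: mem_plus)
      qed
    qed (use c in simp)
    have z: "inv a \<otimes> y = b \<otimes> k"
      using c by (simp add: yvk vab m_assoc inv_cancel_left)
    have "(\<alpha> ^^ n) (b \<otimes> k) \<in> P"
    proof (rule bounded_forward_orbit[OF lc])
      show "compactin T (U <#> K)"
        using compact_open K(2) by (auto simp: compact_open_subgroup_def intro: compactin_set_mult)
      show "b \<otimes> k \<in> P"
        using a y P_subgroup unfolding z[symmetric]
        by (blast intro: subgroup.m_closed subgroup.m_inv_closed)
      show "(\<alpha> ^^ j) (b \<otimes> k) \<in> U <#> K" for j
        using b Kfwd[OF k] c by (auto simp: fwd_mult mem_minus set_mult_def)
    qed
    moreover have "(\<alpha> ^^ n) y = (\<alpha> ^^ n) a \<otimes> (\<alpha> ^^ n) (b \<otimes> k)"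
      using c by (simp add: yvk vab fwd_mult m_assoc)
    ultimately show "(\<alpha> ^^ n) y \<in> P"
      using a_n P_subgroup by (simp add: subgroup.m_closed)
  qed
  show "P \<subseteq> (\<alpha> ^^ n) ` (P \<inter> (V n <#> K))"
  proof
    fix x assume x: "x \<in> P"
    then have c: "x \<in> carrier G" "(\<beta> ^^ n) x \<in> P"
      using P_carrier P_bwd by auto
    \<comment> \<open>The forward iterates of this point up to time \<open>n\<close> are backward
      iterates of \<open>x\<close>, all of them in \<open>P\<close>.\<close>
    have "(\<beta> ^^ n) x \<in> V n"
      using x c P_bwd P_le_U by (auto simp: V_def bwd_fwd_le)
    then have "(\<beta> ^^ n) x \<otimes> \<one> \<in> V n <#> K"
      using Ksub(1) subgroup.one_closed unfolding set_mult_def by fastforce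
    then have "(\<beta> ^^ n) x \<in> P \<inter> (V n <#> K)"
      using c by simp
    then show "x \<in> (\<alpha> ^^ n) ` (P \<inter> (V n <#> K))"
      using c by (metis fwd_bwd imageI)
  qed
qed

lemma index_VK:
  assumes lc: "locally_compact_space T" and K: "K \<lhd> G" "compactin T K" "\<alpha> ` K \<subseteq> K"
  shows "group_index G (U <#> K) (V n <#> K) = group_index G ((\<alpha> ^^ n) ` P) P"
proof -
  interpret hom: group_hom G G "\<alpha> ^^ n"
    by (rule group_hom_fwd)
  have VK: "subgroup (V n <#> K) G"
    using compact_open_subgroup_set_mult[OF compact_open_V K(1,2)] by (simp add: compact_open_subgroup_def)
  then have PVK: "subgroup (P \<inter> (V n <#> K)) G"
    using P_subgroup by (intro subgroups_Inter_pair)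
  have "kernel G G (\<alpha> ^^ n) = {\<one>}"
    using iso_fwd hom.inj_iff_trivial_ker by (auto simp: iso_def bij_betw_def)
  then have ker: "kernel G G (\<alpha> ^^ n) \<subseteq> P \<inter> (V n <#> K)"
    using PVK subgroup.one_closed by fastforce
  have "group_index G (U <#> K) (V n <#> K) = group_index G P (P \<inter> (V n <#> K))"
    using group_index_set_mult[OF P_subgroup VK] set_mult_VK_P[OF K(1)] by simp
  also have "\<dots> = group_index G ((\<alpha> ^^ n) ` P) ((\<alpha> ^^ n) ` (P \<inter> (V n <#> K)))"
    using hom.group_index_image[OF PVK P_subgroup ker] by simp
  finally show ?thesis
    using fwd_image_P_Int_VK[OF lc K] by simp
qed

text \<open>The index of \<open>W \<inter> ?N\<close> in \<open>?M\<close> is computed along two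
  towers, through \<open>W \<inter> ?M\<close> and through \<open>?N\<close>. The second one yields
  the factor \<open>p ^ n\<close>, which the bottom index of the first is too small to
  absorb.\<close>

lemma prime_dvd_index_above:
  assumes lc: "locally_compact_space T" and K: "K \<lhd> G" "compactin T K" "\<alpha> ` K \<subseteq> K"
    and W: "compact_open_subgroup G T W" "K \<subseteq> W"
    and p: "prime p" "p dvd group_index G (\<alpha> ` P) P"
  shows "\<exists>D. compact_open_subgroup G T D \<and> K \<subseteq> D \<and> D \<subseteq> W \<and> p dvd group_index G W D"
proof -
  let ?M = "U <#> K"
  \<comment> \<open>This index does not involve any \<open>V n\<close>, so it can itself serve as
    the number of steps: \<open>0 < n < p ^ n\<close> keeps \<open>p ^ n\<close> from dividing
    it.\<close>
  define n where "n = group_index G ?M (W \<inter> ?M)"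
  let ?N = "V n <#> K"
  have M: "compact_open_subgroup G T ?M" and N': "compact_open_subgroup G T ?N"
    using compact_open_subgroup_set_mult K compact_open compact_open_V by auto
  have NM: "?N \<subseteq> ?M"
    by (simp add: mono_set_mult V_le_U)
  have KN: "K \<subseteq> ?N"
  proof
    fix k assume k: "k \<in> K"
    then have "k = \<one> \<otimes> k"
      using subgroup.mem_carrier[OF normal_imp_subgroup[OF K(1)]] by simp
    then show "k \<in> ?N"
      using k subgroup.one_closed[OF V_subgroup] unfolding set_mult_def by blast
  qed
  have co: "compact_open_subgroup G T (W \<inter> ?M)" "compact_open_subgroup G T (W \<inter> ?N)"
    using W M N' by (auto intro: compact_open_subgroup_Int)
  have sg: "subgroup W G" "subgroup ?M G" "subgroup ?N G" "subgroup (W \<inter> ?M) G" "subgroup (W \<inter> ?N) G"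
    using W M N' co by (auto simp: compact_open_subgroup_def)
  have "group_index G ?M (W \<inter> ?M) * group_index G (W \<inter> ?M) (W \<inter> ?N) = group_index G ?M (W \<inter> ?N)"
    using sg NM by (intro group_index_mult[symmetric]) auto
  also have "\<dots> = group_index G ?M ?N * group_index G ?N (W \<inter> ?N)"
    using sg NM by (intro group_index_mult) auto
  finally have "p ^ n dvd n * group_index G (W \<inter> ?M) (W \<inter> ?N)"
    unfolding n_def[symmetric] using prime_power_dvd_index[OF p(2)] index_VK[OF lc K] by simp
  moreover have "n > 0"
    unfolding n_def using finite_index[OF co(1) M] by simp
  moreover from this have "\<not> p ^ n dvd n"
    using p(1) by (meson dvd_imp_le leD less_exp power_mono order_less_le_trans prime_ge_2_nat zero_le)
  \<comment> \<open>Otherwise \<open>p ^ n\<close> would be coprime to this factor and would have to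
    divide \<open>n\<close>.\<close>
  ultimately have "p dvd group_index G (W \<inter> ?M) (W \<inter> ?N)"
    using p(1) by (metis coprime_dvd_mult_left_iff coprime_power_left_iff prime_imp_coprime)
  moreover have "group_index G W (W \<inter> ?N) = group_index G W (W \<inter> ?M) * group_index G (W \<inter> ?M) (W \<inter> ?N)"
    using sg NM by (intro group_index_mult) auto
  ultimately show ?thesis
    using co(2) W(2) KN by (intro exI[of _ "W \<inter> ?N"]) auto
qed

end

section \<open>Inner automorphisms\<close>

lemma (in topological_group) compactin_trivial: "compactin T {\<one>}"
  by (simp add: topspace_eq)

lemma (in topological_group) inner_automorphism_closed:
  assumes x: "x \<in> carrier G"
  shows "inner_automorphism G x \<in> topological_automorphisms G T"
proof -
  let ?i = "inner_automorphism G x" and ?j = "inner_automorphism G (inv x)"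
  have hom: "?i \<in> hom G G"
    using x by (auto simp: hom_def inner_automorphism_def m_assoc inv_cancel_left)
  have ij: "?i (?j y) = y" "?j (?i y) = y" if "y \<in> carrier G" for y
    using x that by (simp_all add: inner_automorphism_def m_assoc inv_cancel_left)
  have cont: "continuous_map T T (inner_automorphism G y)" if "y \<in> carrier G" for y
    unfolding inner_automorphism_def using that
    by (intro continuous_map_mult) (auto simp: topspace_eq)
  have "homeomorphic_maps T T ?i ?j"
    unfolding homeomorphic_maps_def using x cont ij by (simp add: topspace_eq)
  then have "homeomorphic_map T T ?i"
    using homeomorphic_map_maps by blast
  moreover from this have "bij_betw ?i (carrier G) (carrier G)"
    using homeomorphic_eq_everything_map[of T T ?i] by (simp add: bij_betw_def topspace_eq)
  ultimately show ?thesis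
    using hom by (simp add: topological_automorphisms_def iso_def)
qed

section \<open>Quotients by compact normal subgroups\<close>

text \<open>The complement is a union of open cosets. Serves to prove compactness of preimages under
  the projection.\<close>

lemma (in topological_group) open_subgroup_closed:
  assumes W: "subgroup W G" "openin T W"
  shows "closedin T W"
proof -
  have Wc: "W \<subseteq> carrier G"
    by (intro subgroup.subset W)
  have "carrier G - W = (\<Union>x\<in>carrier G - W. W #> x)"
  proof (intro equalityI subsetI)
    fix x assume "x \<in> carrier G - W"
    then show "x \<in> (\<Union>x\<in>carrier G - W. W #> x)"
      using rcos_self W(1) by blast
  next
    fix y assume "y \<in> (\<Union>x\<in>carrier G - W. W #> x)"
    then obtain x w where x: "x \<in> carrier G" "x \<notin> W" "w \<in> W" "y = w \<otimes> x"
      by (auto simp: r_coset_def)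
    have "x = inv w \<otimes> y"
      using x Wc by (simp add: subset_iff inv_cancel_left)
    then have "y \<notin> W"
      using x W(1) by (metis subgroup.m_closed subgroup.m_inv_closed)
    then show "y \<in> carrier G - W"
      using x Wc by auto
  qed
  moreover have "openin T (\<Union>x\<in>carrier G - W. W #> x)"
    using W(2) openin_r_coset by (intro openin_Union) auto
  ultimately show ?thesis
    using Wc by (simp add: closedin_def topspace_eq)
qed

text \<open>Compact open subgroups of the quotient come from those of \<open>G\<close> that contain
  \<open>K\<close>, with the same indices. The work lies in showing that preimages are compact;
  \<open>U\<close> supplies compact open sets to cover them.\<close>

lemma (in topological_group) local_prime_content_quotient:
  assumes K: "K \<lhd> G" "compactin T K" and U: "compact_open_subgroup G T U"
    and p: "prime p"
    and above: "\<And>W. compact_open_subgroup G T W \<Longrightarrow> K \<subseteq> W \<Longrightarrow>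
      \<exists>D. compact_open_subgroup G T D \<and> K \<subseteq> D \<and> D \<subseteq> W \<and> p dvd group_index G W D"
  shows "p \<in> local_prime_content (G Mod K) (quotient_group_topology G T K)"
proof -
  let ?Q = "G Mod K" and ?S = "quotient_group_topology G T K" and ?\<pi> = "\<lambda>x. K #> x"
  have Ksub: "subgroup K G" "K \<subseteq> carrier G"
    using K by (auto simp: normal_imp_subgroup subgroup.subset)
  interpret hom: group_hom G ?Q ?\<pi>
    using K(1) by (simp add: group_hom_def group_hom_axioms_def is_group normal.factorgroup_is_group normal.r_coset_hom_Mod)
  have ker: "kernel G ?Q ?\<pi> = K"
    using Ksub coset_join1 coset_join2 by (auto simp: kernel_def FactGroup_def)
  have quot: "quotient_map T ?S ?\<pi>"
    by (rule quotient_map_quotient_group_topology)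
  \<comment> \<open>Sets stable under \<open>K\<close> are saturated for the projection, so that
    images of open ones are open.\<close>
  have preimage: "{x \<in> topspace T. ?\<pi> x \<in> ?\<pi> ` A} = A"
    if A: "A \<subseteq> carrier G" and stable: "\<And>k a. k \<in> K \<Longrightarrow> a \<in> A \<Longrightarrow> k \<otimes> a \<in> A" for A
  proof (intro equalityI subsetI)
    fix x assume "x \<in> {x \<in> topspace T. ?\<pi> x \<in> ?\<pi> ` A}"
    then obtain a where "a \<in> A" "x \<in> carrier G" "K #> x = K #> a"
      by (auto simp: topspace_eq)
    then have "x \<in> K #> a"
      using rcos_self[OF _ Ksub(1)] by metis
    then show "x \<in> A"
      using stable \<open>a \<in> A\<close> by (auto simp: r_coset_def)
  qed (use A in \<open>auto simp: topspace_eq\<close>)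
  have open_image: "openin ?S (?\<pi> ` A)"
    if A: "openin T A" and stable: "\<And>k a. k \<in> K \<Longrightarrow> a \<in> A \<Longrightarrow> k \<otimes> a \<in> A" for A
  proof -
    have "A \<subseteq> carrier G"
      using A openin_subset by (force simp: topspace_eq)
    then show ?thesis
      using preimage[OF _ stable] A by (auto simp: openin_quotient_group_topology FactGroup_def RCOSETS_def)
  qed
  \<comment> \<open>A compact open subgroup containing \<open>K\<close>; its right cosets are
    therefore compact, open and saturated.\<close>
  define H where "H = U <#> K"
  have H: "compact_open_subgroup G T H"
    unfolding H_def using U K by (rule compact_open_subgroup_set_mult)
  then have Hsub: "subgroup H G" "H \<subseteq> carrier G"
    by (auto simp: compact_open_subgroup_def subgroup.subset)
  have KH: "K \<subseteq> H"
  proof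
    fix k assume k: "k \<in> K"
    then have "k = \<one> \<otimes> k" "\<one> \<in> U"
      using Ksub U by (auto simp: compact_open_subgroup_def subgroup.one_closed)
    then show "k \<in> H"
      using k unfolding H_def set_mult_def by blast
  qed
  have "\<exists>D'. compact_open_subgroup ?Q ?S D' \<and> D' \<subseteq> W' \<and> p dvd group_index ?Q W' D'"
    if W': "compact_open_subgroup ?Q ?S W'" for W'
  proof -
    let ?W = "{x \<in> topspace T. ?\<pi> x \<in> W'}"
    have W'sub: "subgroup W' ?Q" "compactin ?S W'" "openin ?S W'"
      using W' by (auto simp: compact_open_subgroup_def)
    have piW: "?\<pi> ` ?W = W'"
      using subgroup.subset[OF W'sub(1)] by (auto simp: FactGroup_def RCOSETS_def topspace_eq)
    have W_subgroup: "subgroup ?W G"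
    proof (rule subgroupI)
      show "?W \<noteq> {}"
        using piW subgroup.one_closed[OF W'sub(1)] by blast
      show "?W \<subseteq> carrier G"
        by (auto simp: topspace_eq)
      show "inv a \<in> ?W" if "a \<in> ?W" for a
        using that hom.hom_inv[of a] subgroup.m_inv_closed[OF W'sub(1)] by (simp add: topspace_eq)
      show "a \<otimes> b \<in> ?W" if "a \<in> ?W" "b \<in> ?W" for a b
        using that hom.hom_mult[of a b] subgroup.m_closed[OF W'sub(1)] by (simp add: topspace_eq)
    qed
    have W_open: "openin T ?W"
      using W'sub(3) by (simp add: openin_quotient_group_topology)
    let ?\<C> = "(\<lambda>w. ?\<pi> ` (H #> w)) ` ?W"
    have "\<forall>X \<in> ?\<C>. openin ?S X"
    proof clarify
      fix w assume w: "w \<in> topspace T"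
      show "openin ?S (?\<pi> ` (H #> w))"
      proof (rule open_image)
        show "openin T (H #> w)"
          using H w openin_r_coset by (simp add: compact_open_subgroup_def topspace_eq)
        fix k a assume "k \<in> K" "a \<in> H #> w"
        then obtain h where h: "h \<in> H" "a = h \<otimes> w" "k \<in> H"
          using KH by (auto simp: r_coset_def)
        then have "k \<otimes> a = (k \<otimes> h) \<otimes> w"
          using Hsub w by (simp add: m_assoc subset_iff topspace_eq)
        moreover have "k \<otimes> h \<in> H"
          using h Hsub by (simp add: subgroup.m_closed)
        ultimately show "k \<otimes> a \<in> H #> w"
          by (auto simp: r_coset_def)
      qed
    qed
    moreover have "W' \<subseteq> \<Union>?\<C>"
    proof
      fix X assume "X \<in> W'"
      then obtain w where w: "w \<in> ?W" "X = ?\<pi> w"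
        using piW by (metis (no_types, lifting) imageE)
      then have "w \<in> H #> w"
        using rcos_self[OF _ Hsub(1)] by (simp add: topspace_eq)
      then have "X \<in> ?\<pi> ` (H #> w)"
        unfolding w(2) by (rule imageI)
      then show "X \<in> \<Union>?\<C>"
        using w(1) by (intro UnionI[OF imageI])
    qed
    ultimately obtain F where F: "finite F" "F \<subseteq> ?W" "W' \<subseteq> \<Union>((\<lambda>w. ?\<pi> ` (H #> w)) ` F)"
      by (rule compactin_indexed_subcover[OF W'sub(2)])
    \<comment> \<open>A point of the preimage agrees modulo \<open>K\<close> with a point of some
      \<open>H #> w\<close>, and \<open>K \<subseteq> H\<close> absorbs the difference.\<close>
    have "?W \<subseteq> (\<Union>w\<in>F. H #> w)"
    proof
      fix x assume "x \<in> ?W"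
      then have "K #> x \<in> \<Union>((\<lambda>w. ?\<pi> ` (H #> w)) ` F)" "x \<in> carrier G"
        using subsetD[OF F(3)] by (simp_all add: topspace_eq)
      then obtain w a where "w \<in> F" "a \<in> H #> w" "K #> x = K #> a"
        by blast
      then obtain h where w: "w \<in> F" "h \<in> H" "x \<in> carrier G" "w \<in> carrier G" "K #> x = K #> (h \<otimes> w)"
        using F(2) \<open>x \<in> carrier G\<close> by (auto simp: r_coset_def[of _ H] topspace_eq)
      then have "x \<in> K #> (h \<otimes> w)"
        using rcos_self[OF _ Ksub(1)] by metis
      then obtain k where k: "k \<in> K" "x = k \<otimes> (h \<otimes> w)"
        by (auto simp: r_coset_def)
      then have "x = (k \<otimes> h) \<otimes> w" "k \<otimes> h \<in> H"
        using w KH Hsub by (auto simp: m_assoc subset_iff subgroup.m_closed)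
      then show "x \<in> (\<Union>w\<in>F. H #> w)"
        using w(1) unfolding r_coset_def by blast
    qed
    moreover have "compactin T (\<Union>w\<in>F. H #> w)"
    proof (rule compactin_Union)
      show "finite ((\<lambda>w. H #> w) ` F)"
        using F by simp
      show "compactin T X" if "X \<in> (\<lambda>w. H #> w) ` F" for X
        using that F H compactin_set_mult[of H]
        by (auto simp: r_coset_eq_set_mult compact_open_subgroup_def)
    qed
    ultimately have "compactin T ?W"
      using closed_compactin open_subgroup_closed[OF W_subgroup W_open] by blast
    then have "compact_open_subgroup G T ?W"
      using W_subgroup W_open by (simp add: compact_open_subgroup_def)
    moreover have "K \<subseteq> ?W"
    proof
      fix k assume "k \<in> K"
      then have "K #> k = \<one>\<^bsub>?Q\<^esub>" "k \<in> carrier G"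
        using Ksub coset_join2[of k K] by (auto simp: FactGroup_def)
      then show "k \<in> ?W"
        using subgroup.one_closed[OF W'sub(1)] by (simp add: topspace_eq)
    qed
    ultimately obtain D where D: "compact_open_subgroup G T D" "K \<subseteq> D" "D \<subseteq> ?W" "p dvd group_index G ?W D"
      using above by blast
    then have Dsub: "subgroup D G" "compactin T D" "openin T D"
      by (auto simp: compact_open_subgroup_def)
    have "openin ?S (?\<pi> ` D)"
      using Dsub D(2) by (intro open_image) (auto intro: subgroup.m_closed)
    moreover have "compactin ?S (?\<pi> ` D)"
      using Dsub(2) quotient_imp_continuous_map[OF quot] by (rule image_compactin)
    moreover have "subgroup (?\<pi> ` D) ?Q"
      using Dsub(1) by (rule hom.subgroup_img_is_subgroup)
    moreover have "group_index ?Q W' (?\<pi> ` D) = group_index G ?W D"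
      using hom.group_index_image[OF Dsub(1) W_subgroup] ker D(2) piW by simp
    moreover have "?\<pi> ` D \<subseteq> W'"
      using D(3) piW by blast
    ultimately show ?thesis
      using D(4) unfolding compact_open_subgroup_def by metis
  qed
  then show ?thesis
    using p by (auto simp: local_prime_content_def)
qed

section \<open>Prime divisors of the scale\<close>

lemma (in tdlc_group) dvd_scale_imp_dvd_index:
  assumes \<alpha>: "\<alpha> \<in> topological_automorphisms G T" and r: "has_scale G T \<alpha> r" and p: "prime p" "p dvd r"
    and K: "K \<lhd> G" "compactin T K" "\<alpha> ` K \<subseteq> K"
    and W: "compact_open_subgroup G T W" "K \<subseteq> W"
  shows "\<exists>D. compact_open_subgroup G T D \<and> K \<subseteq> D \<and> D \<subseteq> W \<and> p dvd group_index G W D"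
proof -
  obtain U where U: "tidy G T \<alpha> U" "r = group_index G (\<alpha> ` tidy_plus \<alpha> U) (tidy_plus \<alpha> U)"
    using r by (auto simp: has_scale_def)
  interpret tidy_subgroup G T \<alpha> U
    using \<alpha> U(1) by unfold_locales
  show ?thesis
    using prime_dvd_index_above[OF locally_compact K W] p U(2) by simp
qed

theorem proposition6p2:
  fixes G :: "('a, 'b) monoid_scheme" and T :: "'a topology"
  assumes "tdlc_group G T"
  shows "(\<forall>\<alpha> \<in> topological_automorphisms G T. \<forall>r. has_scale G T \<alpha> r \<longrightarrow>
            {p. prime p \<and> p dvd r} \<subseteq> local_prime_content G T) \<and>
         prime_content G T \<subseteq> local_prime_content G T \<and>
         prime_content G T \<subseteq> reduced_prime_content G T"
proof -
  interpret tdlc_group G T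
    by (rule assms)
  have local: "p \<in> local_prime_content G T"
    if \<alpha>: "\<alpha> \<in> topological_automorphisms G T" "has_scale G T \<alpha> r" "prime p" "p dvd r" for \<alpha> r p
  proof -
    have "group_hom G G \<alpha>"
      using \<alpha>(1) by (simp add: topological_automorphisms_def iso_def group_hom_def group_hom_axioms_def)
    \<comment> \<open>Every automorphism preserves the trivial subgroup, so taking it for
      \<open>K\<close> handles arbitrary \<open>\<alpha>\<close>.\<close>
    then have one: "\<alpha> ` {\<one>\<^bsub>G\<^esub>} \<subseteq> {\<one>\<^bsub>G\<^esub>}"
      by (simp add: group_hom.hom_one)
    have "\<exists>D. compact_open_subgroup G T D \<and> D \<subseteq> W \<and> p dvd group_index G W D"
      if W: "compact_open_subgroup G T W" for W
    proof -
      have "{\<one>\<^bsub>G\<^esub>} \<subseteq> W"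
        using W by (simp add: compact_open_subgroup_def subgroup.one_closed)
      then show ?thesis
        using dvd_scale_imp_dvd_index[OF \<alpha> one_is_normal compactin_trivial one W] by blast
    qed
    then show ?thesis
      using \<alpha>(3) by (simp add: local_prime_content_def)
  qed
  have reduced: "p \<in> reduced_prime_content G T"
    if x: "x \<in> carrier G" and r: "has_scale G T (inner_automorphism G x) r" and p: "prime p" "p dvd r" for x r p
    unfolding reduced_prime_content_def
  proof clarify
    fix K assume K: "K \<lhd> G" "compactin T K"
    \<comment> \<open>Normality is invariance under inner automorphisms, which is why every compact
      normal \<open>K\<close> is admissible for the scale function.\<close>
    have stable: "inner_automorphism G x ` K \<subseteq> K"
      using K(1) x by (auto simp: inner_automorphism_def normal.inv_op_closed2)
    \<comment> \<open>A compact open subgroup is at hand because the scale comes from a tidy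
      one.\<close>
    obtain U where "compact_open_subgroup G T U"
      using r by (auto simp: has_scale_def tidy_def)
    then show "p \<in> local_prime_content (G Mod K) (quotient_group_topology G T K)"
      using local_prime_content_quotient[OF K _ p(1)]
        dvd_scale_imp_dvd_index[OF inner_automorphism_closed[OF x] r p K stable] by blast
  qed
  show ?thesis
    unfolding prime_content_def using local reduced inner_automorphism_closed by blast
qed

end
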